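(* Let $\alpha = \frac{56733}{60064} \approx 0.944542$. For every $\varepsilon > 0$ there exists a positive integer $N$ such that $\rho(n) > (\alpha - \varepsilon)\, n$ for every integer $n \geq N$.
   Context: A string is a finite sequence of symbols from a finite alphabet; $w[i]$ denotes its $i$-th symbol and $w[i:j]$ the substring from position $i$ to position $j$. A string $u$ has period $p$ if $u[i]=u[i+p]$ for $1\le i\le |u|-p$. A string $u$ is a run if its minimum period $p$ satisfies $p \leq |u|/2$. A substring $u = w[i:j]$ of $w$ is a run in $w$ if it is a run of (minimum) period $p$ and neither $w[i-1:j]$ nor $w[i:j+1]$ (whenever these exist) is a run of period $p$, i.e. the run is maximal. Runs in $w$ are counted as distinct pairs of positions $(i,j)$. $\mathrm{run}(w)$ denotes the number of runs in $w$, and $\rho(n)$ denotes the maximum of $\mathrm{run}(w)$ over all strings $w$ of length $n$ (over any finite alphabet). *)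

theory Defs
  imports Complex_Main
begin

text \<open>
  Strings are lists; their alphabet is automatically finite. Positions are 1-based and
  intervals of positions are closed, so the symbol \<open>w[i]\<close> is \<open>w ! (i - 1)\<close>.
\<close>

definition has_period :: "'a list \<Rightarrow> nat \<Rightarrow> bool" where
  "has_period u p \<longleftrightarrow>
     p \<ge> 1 \<and> (\<forall>i. 1 \<le> i \<and> i + p \<le> length u \<longrightarrow> u ! (i - 1) = u ! (i + p - 1))"

text \<open>The minimum exists: every \<open>p \<ge> max 1 (length u)\<close> is vacuously a period.\<close>

definition min_period :: "'a list \<Rightarrow> nat" where
  "min_period u = (LEAST p. has_period u p)"

text \<open>\<open>p \<le> |u| / 2\<close> is written without division; the empty string is not a run,
  its minimum period being 1.\<close>

definition run_of_period :: "'a list \<Rightarrow> nat \<Rightarrow> bool" where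
  "run_of_period u p \<longleftrightarrow> min_period u = p \<and> 2 * p \<le> length u"

text \<open>\<open>w[i:j]\<close>, meaningful for \<open>1 \<le> i \<le> j \<le> length w\<close>.\<close>

definition substring :: "'a list \<Rightarrow> nat \<Rightarrow> nat \<Rightarrow> 'a list" where
  "substring w i j = take (j + 1 - i) (drop (i - 1) w)"

definition run_in :: "'a list \<Rightarrow> nat \<Rightarrow> nat \<Rightarrow> bool" where
  "run_in w i j \<longleftrightarrow> 1 \<le> i \<and> i \<le> j \<and> j \<le> length w \<and>
     (\<exists>p. run_of_period (substring w i j) p \<and>
        \<not> (i > 1 \<and> run_of_period (substring w (i - 1) j) p) \<and>
        \<not> (j < length w \<and> run_of_period (substring w i (j + 1)) p))"

definition num_runs :: "'a list \<Rightarrow> nat" where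
  "num_runs w = card {(i, j). run_in w i j}"

text \<open>
  Since a string uses only finitely many symbols, its symbols can be renamed injectively to
  natural numbers without changing its runs. Hence taking the maximum over strings of natural
  numbers covers all finite alphabets; see \<open>num_runs_le_rho\<close> and \<open>rho_attained\<close> below.
\<close>

definition rho :: "nat \<Rightarrow> nat" where
  "rho n = Max {num_runs w | w :: nat list. length w = n}"

lemma finite_runs: "finite {(i, j). run_in w i j}"
  by (rule finite_subset[of _ "{..length w} \<times> {..length w}"]) (auto simp: run_in_def)

lemma num_runs_le_square: "num_runs w \<le> (length w + 1)\<^sup>2"
proof -
  have "num_runs w \<le> card ({..length w} \<times> {..length w})"
    unfolding num_runs_def by (rule card_mono) (auto simp: run_in_def)
  then show ?thesis by (simp add: card_cartesian_product power2_eq_square)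
qed

lemma finite_num_runs: "finite {num_runs w | w :: nat list. length w = n}"
  by (rule finite_subset[of _ "{..(n + 1)\<^sup>2}"]) (use num_runs_le_square in auto)

lemma rho_attained: "\<exists>w :: nat list. length w = n \<and> num_runs w = rho n"
proof -
  have "num_runs (replicate n (0::nat)) \<in> {num_runs w | w :: nat list. length w = n}"
    by (auto intro!: exI[of _ "replicate n (0::nat)"])
  then have "rho n \<in> {num_runs w | w :: nat list. length w = n}"
    unfolding rho_def using finite_num_runs by (intro Max_in) auto
  then show ?thesis by auto
qed

lemma has_period_map:
  assumes "inj_on f (set u)"
  shows "has_period (map f u) p \<longleftrightarrow> has_period u p"
proof -
  have "map f u ! (i - 1) = map f u ! (i + p - 1) \<longleftrightarrow> u ! (i - 1) = u ! (i + p - 1)"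
    if "1 \<le> i" "i + p \<le> length u" for i
    using that inj_on_eq_iff[OF assms, of "u ! (i - 1)" "u ! (i + p - 1)"] by simp
  then show ?thesis unfolding has_period_def by auto
qed

lemma run_of_period_map:
  assumes "inj_on f (set w)"
  shows "run_of_period (substring (map f w) i j) p \<longleftrightarrow> run_of_period (substring w i j) p"
proof -
  have "set (substring w i j) \<subseteq> set w"
    unfolding substring_def by (rule order_trans[OF set_take_subset set_drop_subset])
  then have "inj_on f (set (substring w i j))"
    by (rule inj_on_subset[OF assms])
  moreover have "substring (map f w) i j = map f (substring w i j)"
    by (simp add: substring_def take_map drop_map)
  ultimately show ?thesis
    by (simp add: run_of_period_def min_period_def has_period_map)
qed

lemma num_runs_le_rho: "num_runs w \<le> rho (length w)"
proof -
  obtain f :: "'a \<Rightarrow> nat" where f: "inj_on f (set w)"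
    using finite_imp_inj_to_nat_seg[of "set w"] by auto
  have "num_runs w = num_runs (map f w)"
    by (simp add: num_runs_def run_in_def run_of_period_map[OF f])
  also have "\<dots> \<le> rho (length w)"
    unfolding rho_def
    by (rule Max_ge[OF finite_num_runs]) (auto intro!: exI[of _ "map f w"])
  finally show ?thesis .
qed

end

theory Submission
  imports Defs
begin

text \<open>
  Say that position \<open>z\<close> of an infinite word \<open>s\<close> matches for \<open>p\<close> if \<open>s z = s (z + p)\<close>. A maximal
  block of at least \<open>p\<close> consecutive matches is a run with period \<open>p\<close>, whether or not \<open>p\<close> is minimal.
  If \<open>s\<close> is periodic with period \<open>N\<close>, the blocks repeat, so \<open>n / N\<close> times the number of blocks per
  period bounds the number of runs in the prefix of length \<open>n\<close> from below, up to a constant,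
  provided that different \<open>p\<close> give different runs.

  The word is the power of a word of length 60064 in the family of modified Padovan words of
  J. Simpson. Its 56733 blocks, for 36 values of \<open>p\<close>, are counted by rewriting; the comparison of
  the word with its shifts is fast because it is built hierarchically, and equal factors of the
  hierarchy are skipped without being expanded.
\<close>

section \<open>Runs from maximal blocks of matches\<close>

lemma has_period_substring:
  assumes "e \<le> length w"
  shows "has_period (substring w (Suc i) e) p \<longleftrightarrow>
    p \<ge> 1 \<and> (\<forall>k. i \<le> k \<longrightarrow> k + p < e \<longrightarrow> w ! k = w ! (k + p))"
proof -
  have nth: "substring w (Suc i) e ! k = w ! (i + k)" if "k < e - i" for k
    using that assms by (simp add: substring_def)
  have len: "length (substring w (Suc i) e) = e - i"
    using assms by (auto simp: substring_def)
  have "(\<forall>j. 1 \<le> j \<and> j + p \<le> e - i \<longrightarrow>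
           substring w (Suc i) e ! (j - 1) = substring w (Suc i) e ! (j + p - 1)) \<longleftrightarrow>
        (\<forall>k. i \<le> k \<longrightarrow> k + p < e \<longrightarrow> w ! k = w ! (k + p))" (is "?l \<longleftrightarrow> ?r") if "p \<ge> 1"
  proof
    assume l: ?l
    show ?r
    proof (intro allI impI)
      fix k assume k: "i \<le> k" "k + p < e"
      with l[rule_format, of "k - i + 1"] show "w ! k = w ! (k + p)"
        using nth[of "k - i"] nth[of "k - i + p"] by simp
    qed
  next
    assume r: ?r
    show ?l
    proof (intro allI impI)
      fix j assume j: "1 \<le> j \<and> j + p \<le> e - i"
      then obtain j' where "j = Suc j'"
        by (cases j) auto
      with j that show "substring w (Suc i) e ! (j - 1) = substring w (Suc i) e ! (j + p - 1)"
        using nth[of j'] nth[of "j' + p"] r[rule_format, of "i + j'"] by (simp add: add.assoc)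
    qed
  qed
  then show ?thesis
    unfolding has_period_def len by blast
qed

text \<open>The minimal period \<open>q\<close> may be smaller than \<open>p\<close>. If the word
  prolonged by one letter still had period \<open>q\<close>, a detour by \<open>q\<close>, then
  \<open>p\<close>, then back by \<open>q\<close>, would make that letter match for
  \<open>p\<close>; the length \<open>2 * p\<close> leaves room for it.\<close>

lemma run_inI:
  assumes "p \<ge> 1" "i + 2 * p \<le> e" "e \<le> length w"
    and per: "\<And>k. i \<le> k \<Longrightarrow> k + p < e \<Longrightarrow> w ! k = w ! (k + p)"
    and left: "i > 0 \<Longrightarrow> w ! (i - 1) \<noteq> w ! (i - 1 + p)"
    and right: "e < length w \<Longrightarrow> w ! (e - p) \<noteq> w ! e"
  shows "run_in w (Suc i) e"
proof -
  define q where "q = min_period (substring w (Suc i) e)"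
  have period_p: "has_period (substring w (Suc i) e) p"
    using assms by (simp add: has_period_substring)
  then have "has_period (substring w (Suc i) e) q"
    unfolding q_def min_period_def by (rule LeastI)
  then have q: "q \<ge> 1" "\<And>k. i \<le> k \<Longrightarrow> k + q < e \<Longrightarrow> w ! k = w ! (k + q)"
    using assms by (auto simp: has_period_substring)
  have "q \<le> p"
    unfolding q_def min_period_def using period_p by (rule Least_le)
  have period_if_run: "has_period u q" if "run_of_period u q" for u :: "'a list"
  proof -
    have "has_period u (length u + 1)" by (simp add: has_period_def)
    then have "has_period u (min_period u)" unfolding min_period_def by (rule LeastI)
    with that show ?thesis by (simp add: run_of_period_def)
  qed
  have not_left: "\<not> run_of_period (substring w i e) q" if "i > 0"
  proof
    assume "run_of_period (substring w i e) q"
    from period_if_run[OF this]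
    have "has_period (substring w (Suc (i - 1)) e) q" using that by simp
    then have "\<forall>k. i - 1 \<le> k \<longrightarrow> k + q < e \<longrightarrow> w ! k = w ! (k + q)"
      using assms(3) by (simp add: has_period_substring)
    then have "w ! (i - 1) = w ! (i - 1 + q)"
      using assms(1,2) \<open>q \<le> p\<close> that by auto
    also have "\<dots> = w ! (i - 1 + q + p)"
      using q(1) \<open>q \<le> p\<close> assms that by (intro per) auto
    also have "\<dots> = w ! (i - 1 + p)"
      using q(2)[of "i - 1 + p"] q(1) \<open>q \<le> p\<close> assms that by (simp add: add_ac)
    finally show False using left[OF that] by simp
  qed
  have not_right: "\<not> run_of_period (substring w (Suc i) (Suc e)) q" if "e < length w"
  proof
    assume "run_of_period (substring w (Suc i) (Suc e)) q"
    from period_if_run[OF this]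
    have "w ! (e - q) = w ! (e - q + q)"
      using assms \<open>q \<le> p\<close> that by (subst (asm) has_period_substring) auto
    then have "w ! e = w ! (e - q)" using assms \<open>q \<le> p\<close> by simp
    also have "\<dots> = w ! (e - q - p)"
      using per[of "e - q - p"] assms \<open>q \<le> p\<close> q(1) by simp
    also have "\<dots> = w ! (e - p)"
      using q(2)[of "e - q - p"] assms \<open>q \<le> p\<close> q(1) by simp
    finally show False using right[OF that] by simp
  qed
  have "run_of_period (substring w (Suc i) e) q"
    using assms(2,3) \<open>q \<le> p\<close> by (simp add: run_of_period_def q_def substring_def)
  then show ?thesis
    unfolding run_in_def using assms(1-3) not_left not_right by (auto intro!: exI[of _ q])
qed

section \<open>Streaks of matches and their scan\<close>

text \<open>
  \<open>streak m c z\<close> is the number of consecutive positions directly before \<open>z\<close> that satisfy \<open>m\<close>, where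
  \<open>c\<close> such positions are assumed to precede position 0.
\<close>

primrec streak :: "(nat \<Rightarrow> bool) \<Rightarrow> nat \<Rightarrow> nat \<Rightarrow> nat" where
  "streak m c 0 = c"
| "streak m c (Suc z) = (if m z then Suc (streak m c z) else 0)"

text \<open>The bound by \<open>z\<close> keeps the streak off the \<open>c\<close> assumed
  positions, about which \<open>m\<close> says nothing.\<close>

lemma streak_match:
  "streak m c z \<le> z \<Longrightarrow> z - streak m c z \<le> k \<Longrightarrow> k < z \<Longrightarrow> m k"
  by (induction z) (auto split: if_splits simp: less_Suc_eq)

lemma streak_maximal:
  "streak m c z < z \<Longrightarrow> \<not> m (z - Suc (streak m c z))"
  by (induction z) (auto split: if_splits)

lemma streak_ge:
  "a \<le> z \<Longrightarrow> (\<And>k. a \<le> k \<Longrightarrow> k < z \<Longrightarrow> m k) \<Longrightarrow> z - a \<le> streak m c z"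
  by (induction z) (auto simp: le_Suc_eq Suc_diff_le)

text \<open>If one period returns to the initial value, the recursion repeats itself, so
  \<open>c\<close> is a consistent guess for the past.\<close>

lemma streak_periodic:
  assumes "streak m c n = c" "\<And>z. m (z + n) = m z"
  shows "streak m c (z + n) = streak m c z"
  by (induction z) (use assms in auto)


text \<open>
  Counts the mismatches of two lists that end a block of at least \<open>p\<close> matches, and fails if a
  block is longer than \<open>2 * p\<close>. The argument \<open>c\<close> is the current streak plus one, so that it is
  always a \<open>numeral\<close> and the evaluation can use binary arithmetic on \<open>num\<close>.
\<close>

fun scan :: "nat \<Rightarrow> nat \<Rightarrow> nat \<Rightarrow> 'a list \<Rightarrow> 'a list \<Rightarrow> (nat \<times> nat) option" where
  "scan p c k [] ys = Some (c, k)"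
| "scan p c k (x # xs) [] = None"
| "scan p c k (x # xs) (y # ys) =
     (if x = y then scan p (c + 1) k xs ys
      else if c \<le> p then scan p 1 k xs ys
      else if c \<le> 2 * p + 1 then scan p 1 (k + 1) xs ys
      else None)"

lemma scan_sound:
  assumes "scan p (streak m c a + 1) k xs ys = Some (c', k')"
    and "\<And>i. i < length xs \<Longrightarrow> m (a + i) \<longleftrightarrow> xs ! i = ys ! i"
  shows "c' = streak m c (a + length xs) + 1 \<and>
    k' = k + card {z \<in> {a..<a + length xs}. \<not> m z \<and> p \<le> streak m c z} \<and>
    (\<forall>z\<in>{a..<a + length xs}. \<not> m z \<longrightarrow> streak m c z \<le> 2 * p)"
  using assms
proof (induction xs arbitrary: a k ys)
  case Nil
  then show ?case by simp
next
  case (Cons x xs)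
  then obtain y ys' where ys: "ys = y # ys'"
    by (cases ys) auto
  have m_a: "m a \<longleftrightarrow> x = y"
    using Cons.prems(2)[of 0] by (simp add: ys)
  have m_Suc: "m (Suc a + i) \<longleftrightarrow> xs ! i = ys' ! i" if "i < length xs" for i
    using Cons.prems(2)[of "Suc i"] that by (simp add: ys)
  define k2 where "k2 = (if \<not> m a \<and> p \<le> streak m c a then k + 1 else k)"
  have scan: "scan p (streak m c (Suc a) + 1) k2 xs ys' = Some (c', k')"
    and le: "\<not> m a \<Longrightarrow> streak m c a \<le> 2 * p"
    using Cons.prems(1) by (auto simp: ys m_a k2_def split: if_splits)
  have int: "{a..<a + length (x # xs)} = insert a {Suc a..<Suc a + length xs}"
    by auto
  have "card {z \<in> {a..<a + length (x # xs)}. \<not> m z \<and> p \<le> streak m c z} + k =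
      card {z \<in> {Suc a..<Suc a + length xs}. \<not> m z \<and> p \<le> streak m c z} + k2"
  proof (cases "\<not> m a \<and> p \<le> streak m c a")
    case True
    then have "{z \<in> {a..<a + length (x # xs)}. \<not> m z \<and> p \<le> streak m c z} =
        insert a {z \<in> {Suc a..<Suc a + length xs}. \<not> m z \<and> p \<le> streak m c z}"
      unfolding int by blast
    with True show ?thesis by (simp add: k2_def)
  next
    case False
    then have "{z \<in> {a..<a + length (x # xs)}. \<not> m z \<and> p \<le> streak m c z} =
        {z \<in> {Suc a..<Suc a + length xs}. \<not> m z \<and> p \<le> streak m c z}"
      unfolding int by blast
    with False show ?thesis by (simp add: k2_def)
  qed
  with Cons.IH[OF scan m_Suc] le show ?case
    unfolding int by auto
qed

section \<open>Lower bound for periodic words\<close>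

text \<open>
  If the same run arose from two blocks for \<open>p < q\<close>, then \<open>2 * q \<le> 3 * p\<close> because blocks for \<open>p\<close> have
  length at most \<open>2 * p\<close>, and comparing the two shifts yields a block of at least \<open>q\<close> matches for
  \<open>q - p\<close>. The assumption \<open>gaps\<close> excludes this.
\<close>

lemma num_runs_periodic_word:
  fixes s :: "nat \<Rightarrow> 'a" and c :: "nat \<Rightarrow> nat" and N :: nat
  defines "m \<equiv> \<lambda>p z. s z = s (z + p)"
  defines "r \<equiv> \<lambda>p. streak (m p) (c p)"
  defines "Z \<equiv> \<lambda>p. {z \<in> {0..<N}. \<not> m p z \<and> p \<le> r p z}"
  assumes periodic: "\<And>z. s (z + N) = s z"
    and "finite P"
    and range: "\<And>p. p \<in> P \<Longrightarrow> 1 \<le> p \<and> p < N"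
    and streak_N: "\<And>p. p \<in> P \<Longrightarrow> r p N = c p"
    and nonempty: "\<And>p. p \<in> P \<Longrightarrow> Z p \<noteq> {}"
    and bound: "\<And>p z. p \<in> P \<Longrightarrow> z < N \<Longrightarrow> \<not> m p z \<Longrightarrow> r p z \<le> 2 * p"
    and gaps: "\<And>p q. p \<in> P \<Longrightarrow> q \<in> P \<Longrightarrow> p < q \<Longrightarrow>
      3 * p < 2 * q \<or> q - p \<in> P \<and> 2 * (q - p) < q"
  shows "(n div N - 3) * (\<Sum>p\<in>P. card (Z p)) \<le> num_runs (map s [0..<n])"
proof -
  have m_periodic: "m p (z + N) = m p z" for p z
    using periodic[of z] periodic[of "z + p"] by (simp add: m_def add_ac)
  have m_shift: "m p (z + j * N) = m p z" for p z j
  proof (induction j)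
    case (Suc j)
    then show ?case using m_periodic[of p "z + j * N"] by (simp add: add_ac)
  qed simp
  have r_shift: "r p (z + j * N) = r p z" if "p \<in> P" for p z j
  proof (induction j)
    case (Suc j)
    have "r p (z + j * N + N) = r p (z + j * N)"
      unfolding r_def using streak_N[OF that] by (intro streak_periodic m_periodic) (simp add: r_def)
    with Suc show ?case by (simp add: add_ac)
  qed simp
  \<comment> \<open>\<open>bound\<close> speaks only of mismatches below \<open>N\<close>. As
    \<open>Z d\<close> is nonempty, mismatches recur, so the block can be prolonged to the first
    mismatch \<open>y\<close> from \<open>b\<close> on, and \<open>y\<close> is then reduced modulo
    \<open>N\<close>.\<close>
  have block: "b - a \<le> 2 * d" if "d \<in> P" and match: "\<And>k. a \<le> k \<Longrightarrow> k < b \<Longrightarrow> m d k" for d a b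
  proof (cases "a \<le> b")
    case True
    obtain z where z: "z < N" "\<not> m d z"
      using nonempty[OF \<open>d \<in> P\<close>] by (auto simp: Z_def)
    define y where "y = (LEAST y. b \<le> y \<and> \<not> m d y)"
    have "b \<le> z + b * N"
      using z(1) by (intro trans_le_add2) simp
    then have "b \<le> z + b * N \<and> \<not> m d (z + b * N)"
      using z by (simp add: m_shift)
    then have y: "b \<le> y \<and> \<not> m d y"
      unfolding y_def by (rule LeastI)
    have "m d k" if "a \<le> k" "k < y" for k
      using not_less_Least[OF that(2)[unfolded y_def]] match[OF that(1)] by (cases "b \<le> k") auto
    then have "y - a \<le> r d y"
      unfolding r_def using True y by (intro streak_ge) auto
    also have "\<dots> = r d (y mod N)"
      using r_shift[OF \<open>d \<in> P\<close>, of "y mod N" "y div N"] by simp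
    also have "\<dots> \<le> 2 * d"
      using y m_shift[of d "y mod N" "y div N"] z(1) by (intro bound \<open>d \<in> P\<close>) auto
    finally show ?thesis using y by linarith
  qed simp
  \<comment> \<open>With \<open>j\<close> at least 2, a block, of length at most
    \<open>2 * p\<close>, starts after position 0. The upper limit puts the end of the run below
    \<open>(j + 2) * N\<close>, hence inside the prefix. This leaves \<open>n div N - 3\<close>
    copies.\<close>
  define I where "I = (SIGMA p:P. Z p \<times> {2..<n div N - 1})"
  define g where "g = (\<lambda>(p, z, j). (Suc (z + j * N - r p z), z + j * N + p))"
  have facts: "p \<in> P" "z < N" "p \<ge> 1" "p < N" "\<not> m p (z + j * N)"
    "r p (z + j * N) = r p z" "p \<le> r p z" "r p z \<le> 2 * p" "r p z < z + j * N"
    "j + 2 \<le> n div N"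
    if "(p, z, j) \<in> I" for p z j
  proof -
    show p: "p \<in> P" and z: "z < N" and "p \<le> r p z" and "j + 2 \<le> n div N"
      and "\<not> m p (z + j * N)"
      using that by (auto simp: I_def Z_def m_shift)
    show "p \<ge> 1" "p < N"
      using range[OF p] by auto
    show "r p (z + j * N) = r p z"
      by (rule r_shift[OF p])
    show le: "r p z \<le> 2 * p"
      using that by (intro bound) (auto simp: I_def Z_def)
    have "2 * N \<le> j * N"
      using that by (intro mult_right_mono) (auto simp: I_def)
    with le \<open>p < N\<close> show "r p z < z + j * N"
      by linarith
  qed
  have matches: "m p k" if "(p, z, j) \<in> I" "z + j * N - r p z \<le> k" "k < z + j * N" for p z j k
    using streak_match[of "m p" "c p" "z + j * N" k] facts[OF that(1)] that(2,3) by (simp add: r_def)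
  have eq_if: "p = q" if "(p, z, j) \<in> I" "(q, z', j') \<in> I" "g (p, z, j) = g (q, z', j')" "p \<le> q"
    for p q z z' j j'
  proof (rule ccontr)
    assume "p \<noteq> q"
    with \<open>p \<le> q\<close> have "p < q" by simp
    note p = facts[OF that(1)] and q = facts[OF that(2)]
    define x where "x = z + j * N"
    define y where "y = z' + j' * N"
    have ends: "x - r p z = y - r q z'" "x + p = y + q" "r p z < x" "r q z' < y"
      using that(3) p(9) q(9) by (auto simp: g_def x_def y_def)
    then have "2 * q \<le> 3 * p"
      using p(8) q(7) by linarith
    with gaps[OF p(1) q(1) \<open>p < q\<close>] have d: "q - p \<in> P" "2 * (q - p) < q"
      by auto
    \<comment> \<open>Matches at \<open>k - p\<close> for both shifts give
      \<open>s k = s (k - p) = s (k + (q - p))\<close>. The range of \<open>k\<close> is as long as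
      the block for \<open>q\<close>.\<close>
    have match: "m (q - p) k" if "x - r p z + p \<le> k" "k < y + p" for k
    proof -
      have "m p (k - p)"
        using that ends \<open>p < q\<close> matches[OF \<open>(p, z, j) \<in> I\<close>, of "k - p"] by (simp add: x_def)
      moreover have "m q (k - p)"
        using that ends matches[OF \<open>(q, z', j') \<in> I\<close>, of "k - p"] by (simp add: y_def)
      ultimately show ?thesis
        using that \<open>p < q\<close> by (simp add: m_def)
    qed
    have "y + p - (x - r p z + p) \<le> 2 * (q - p)"
      by (rule block[OF d(1) match])
    then have "r q z' \<le> 2 * (q - p)"
      using ends by linarith
    with d(2) q(7) show False by linarith
  qed
  have "inj_on g I"
  proof (rule inj_onI)
    fix a b assume "a \<in> I" "b \<in> I" "g a = g b"
    moreover obtain p z j where a: "a = (p, z, j)" by (cases a)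
    moreover obtain q z' j' where b: "b = (q, z', j')" by (cases b)
    ultimately have in_I: "(p, z, j) \<in> I" "(q, z', j') \<in> I"
      and eq: "g (p, z, j) = g (q, z', j')" by auto
    have "p = q"
      using eq_if[OF in_I eq] eq_if[OF in_I(2,1) eq[symmetric]] by linarith
    moreover from this eq have *: "z + j * N = z' + j' * N"
      by (simp add: g_def)
    moreover have "z = z'"
      using arg_cong[OF *, of "\<lambda>x. x mod N"] facts(2)[OF in_I(1)] facts(2)[OF in_I(2)] by simp
    ultimately show "a = b"
      using facts(2)[OF in_I(1)] by (simp add: a b)
  qed
  moreover have "g ` I \<subseteq> {(i, j). run_in (map s [0..<n]) i j}"
  proof clarify
    fix p z j i e
    assume in_I: "(p, z, j) \<in> I" and g: "(i, e) = g (p, z, j)"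
    note p = facts[OF in_I]
    define x where "x = z + j * N"
    have "x + p < (j + 2) * N"
      using p by (simp add: x_def)
    also have "\<dots> \<le> n div N * N"
      using p(10) by (rule mult_right_mono) simp
    also have "\<dots> \<le> n" by simp
    finally have len: "x + p < n" .
    have "run_in (map s [0..<n]) (Suc (x - r p z)) (x + p)"
    proof (rule run_inI)
      show "map s [0..<n] ! k = map s [0..<n] ! (k + p)" if "x - r p z \<le> k" "k + p < x + p" for k
        using matches[OF in_I, of k] that len by (simp add: m_def x_def)
      have "\<not> m p (x - Suc (r p z))"
        using streak_maximal[of "m p" "c p" x] p by (simp add: r_def x_def)
      then show "map s [0..<n] ! (x - r p z - 1) \<noteq> map s [0..<n] ! (x - r p z - 1 + p)"
        using len p(9) by (simp add: m_def x_def)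
      show "map s [0..<n] ! (x + p - p) \<noteq> map s [0..<n] ! (x + p)"
        using p(5) len by (simp add: m_def x_def)
    qed (use p len in \<open>auto simp: x_def\<close>)
    with g show "run_in (map s [0..<n]) i e"
      by (simp add: g_def x_def)
  qed
  ultimately have "card I \<le> num_runs (map s [0..<n])"
    unfolding num_runs_def using finite_runs by (metis card_image card_mono)
  moreover have "card I = (n div N - 3) * (\<Sum>p\<in>P. card (Z p))"
    using \<open>finite P\<close> by (simp add: I_def Z_def card_cartesian_product sum_distrib_left mult.commute
        numeral_3_eq_3)
  ultimately show ?thesis by simp
qed

section \<open>The hierarchical Padovan word\<close>

datatype letter = A | B | C

text \<open>
  \<open>factor l\<close> is the image of a letter under \<open>l\<close> rounds of applying the morphism \<open>padovan_step\<close> and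
  reversing, followed by the coding \<open>padovan_code\<close>; pulling the reversals inwards makes the
  order of the factors alternate.
\<close>

primrec padovan_step :: "letter \<Rightarrow> letter list" where
  "padovan_step A = [A, A, C, A, B]"
| "padovan_step B = [A, C, A, B]"
| "padovan_step C = [A, C]"

primrec padovan_code :: "letter \<Rightarrow> bool list" where
  "padovan_code A = [True, False, True, False, False, True, False, True, True, False, False,
          True, False, True, False, False, True, False, True, True, False, True, False, False]"
| "padovan_code B = [True, False, True, False, False, True, False, True, True, False, True, False, False]"
| "padovan_code C = [True, False, True, False, False, True, False, True]"

primrec factor :: "nat \<Rightarrow> letter \<Rightarrow> bool list" where
  "factor 0 x = padovan_code x"
| "factor (Suc l) x = concat (map (factor l) (if even l then rev (padovan_step x) else padovan_step x))"

definition padovan_word :: "bool list" where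
  "padovan_word = factor 5 C @ factor 5 A @ factor 5 A"

section \<open>Evaluation of scans by rewriting\<close>

text \<open>Marks a factor that is to be opened; a plain \<open>factor l x @ zs\<close> stays
  folded, so factors are opened only on demand.\<close>

definition expand :: "nat \<Rightarrow> letter \<Rightarrow> bool list \<Rightarrow> bool list" where
  "expand l x zs = factor l x @ zs"

lemma expand_0:
  "expand 0 A zs = True # False # True # False # False # True # False # True # True # False #
     False # True # False # True # False # False # True # False # True # True # False # True #
     False # False # zs"
  "expand 0 B zs = True # False # True # False # False # True # False # True # True # False #
     True # False # False # zs"
  "expand 0 C zs = True # False # True # False # False # True # False # True # zs"
  by (simp_all add: expand_def)

lemma expand_Suc:
  "expand (Suc l) A zs =
     (if even l then factor l B @ factor l A @ factor l C @ factor l A @ factor l A @ zs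
      else factor l A @ factor l A @ factor l C @ factor l A @ factor l B @ zs)"
  "expand (Suc l) B zs =
     (if even l then factor l B @ factor l A @ factor l C @ factor l A @ zs
      else factor l A @ factor l C @ factor l A @ factor l B @ zs)"
  "expand (Suc l) C zs = (if even l then factor l C @ factor l A @ zs else factor l A @ factor l C @ zs)"
  by (simp_all add: expand_def)

definition factor_len :: "nat \<Rightarrow> letter \<Rightarrow> num" where
  "factor_len l x = num_of_nat (length (factor l x))"

text \<open>Positivity matters because \<open>num_of_nat\<close> sends 0 to
  \<open>num.One\<close>.\<close>

lemma numeral_factor_len: "numeral (factor_len l x) = length (factor l x)"
proof -
  have "length (factor l x) > 0"
    by (induction l arbitrary: x) (case_tac x; simp)+
  then show ?thesis
    by (simp add: factor_len_def numeral_num_of_nat)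
qed

lemma length_factor_Suc:
  "length (factor (Suc l) A) = 3 * length (factor l A) + length (factor l B) + length (factor l C)"
  "length (factor (Suc l) B) = 2 * length (factor l A) + length (factor l B) + length (factor l C)"
  "length (factor (Suc l) C) = length (factor l A) + length (factor l C)"
  by simp_all

lemma length_factor:
  "length (factor 0 A) = 24" "length (factor 0 B) = 13" "length (factor 0 C) = 8"
  "length (factor (Suc 0) A) = 93" "length (factor (Suc 0) B) = 69" "length (factor (Suc 0) C) = 32"
  "length (factor (Suc (Suc 0)) A) = 380" "length (factor (Suc (Suc 0)) B) = 287"
  "length (factor (Suc (Suc 0)) C) = 125"
  "length (factor (Suc (Suc (Suc 0))) A) = 1552" "length (factor (Suc (Suc (Suc 0))) B) = 1172"
  "length (factor (Suc (Suc (Suc 0))) C) = 505"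
  "length (factor (Suc (Suc (Suc (Suc 0)))) A) = 6333"
  "length (factor (Suc (Suc (Suc (Suc 0)))) B) = 4781"
  "length (factor (Suc (Suc (Suc (Suc 0)))) C) = 2057"
  "length (factor (Suc (Suc (Suc (Suc (Suc 0))))) A) = 25837"
  "length (factor (Suc (Suc (Suc (Suc (Suc 0))))) B) = 19504"
  "length (factor (Suc (Suc (Suc (Suc (Suc 0))))) C) = 8390"
  by (simp_all only: length_factor_Suc) simp_all

lemma factor_len_eqI: "length (factor l x) = numeral n \<Longrightarrow> factor_len l x = n"
  by (metis numeral_factor_len numeral_eq_iff)

lemmas factor_len_table = length_factor[THEN factor_len_eqI]

lemma scan_skip:
  "scan p (numeral c) k (factor l x @ xs) (factor l x @ ys) =
     scan p (numeral (c + factor_len l x)) k xs ys"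
proof -
  have "scan p c k (zs @ xs) (zs @ ys) = scan p (c + length zs) k xs ys" for c zs
    by (induction zs arbitrary: c) auto
  then show ?thesis
    by (simp only: numeral_add numeral_factor_len)
qed

text \<open>Opens the higher of two factors, both of them if they differ at one level, and a factor
  facing a bit, until \<open>scan_skip\<close> or a rule for bits applies.\<close>

lemma scan_expand:
  "l < m \<Longrightarrow> scan p c k (factor l x @ xs) (factor m y @ ys) =
     scan p c k (factor l x @ xs) (expand m y ys)"
  "m < l \<Longrightarrow> scan p c k (factor l x @ xs) (factor m y @ ys) =
     scan p c k (expand l x xs) (factor m y @ ys)"
  "x \<noteq> y \<Longrightarrow> scan p c k (factor l x @ xs) (factor l y @ ys) =
     scan p c k (expand l x xs) (expand l y ys)"
  "scan p c k (b # bs) (factor m y @ ys) = scan p c k (b # bs) (expand m y ys)"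
  "scan p c k (factor l x @ xs) (b # bs) = scan p c k (expand l x xs) (b # bs)"
  by (simp_all only: expand_def)

lemma scan_match:
  "scan p (numeral c) k (True # xs) (True # ys) = scan p (numeral (c + num.One)) k xs ys"
  "scan p (numeral c) k (False # xs) (False # ys) = scan p (numeral (c + num.One)) k xs ys"
  by (simp_all only: scan.simps numeral_add numeral_One if_True refl)

lemma scan_mismatch:
  assumes "x \<noteq> y"
  shows "scan (numeral p) (numeral c) (numeral k) (x # xs) (y # ys) =
    (if c \<le> p then scan (numeral p) (numeral num.One) (numeral k) xs ys
     else if c \<le> num.Bit1 p then scan (numeral p) (numeral num.One) (numeral (k + num.One)) xs ys
     else None)"
proof -
  have "2 * numeral p + 1 = (numeral (num.Bit1 p) :: nat)"
    by (simp only: numeral_Bit1 mult_2)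
  then show ?thesis
    using assms by (simp only: scan.simps numeral_le_iff numeral_add numeral_One if_False)
qed

text \<open>Counting up from \<open>c\<close> to \<open>d\<close> needs only addition and comparison
  on \<open>num\<close>, and drops whole factors unopened.\<close>

definition drop_to :: "nat \<Rightarrow> nat \<Rightarrow> 'a list \<Rightarrow> 'a list" where
  "drop_to d c zs = drop (d - c) zs"

text \<open>Both counters are shifted by one, since no \<open>num\<close> stands for 0.\<close>

lemma drop_eq_drop_to: "drop (numeral d) zs = drop_to (numeral (d + num.One)) (numeral num.One) zs"
  by (simp only: drop_to_def numeral_add add_diff_cancel_right')

lemma drop_to_factor:
  "drop_to (numeral d) (numeral c) (factor l x @ zs) =
     (if c + factor_len l x \<le> d then drop_to (numeral d) (numeral (c + factor_len l x)) zs
      else drop_to (numeral d) (numeral c) (expand l x zs))"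
proof -
  have "drop_to d c (us @ zs) = (if c + length us \<le> d then drop_to d (c + length us) zs
      else drop_to d c (us @ zs))" for c d and us :: "bool list"
    by (simp add: drop_to_def)
  then show ?thesis
    by (simp only: expand_def numeral_le_iff[symmetric, where 'a = nat] numeral_add
        numeral_factor_len)
qed

lemma drop_to_Cons:
  "drop_to (numeral d) (numeral c) (z # zs) =
     (if c < d then drop_to (numeral d) (numeral (c + num.One)) zs else z # zs)"
proof -
  have "drop_to d c (z # zs) = (if c < d then drop_to d (c + 1) zs else z # zs)" for c d
    by (simp add: drop_to_def drop_Cons')
  then show ?thesis
    by (simp only: numeral_less_iff[symmetric, where 'a = nat] numeral_add numeral_One)
qed

lemma drop_to_refl: "drop_to d d zs = zs"
  by (simp add: drop_to_def)

section \<open>Scans for all shifts\<close>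

text \<open>
  The entries are \<open>(p, c, k)\<close>: \<open>p\<close> is a shift, \<open>c\<close> is the number of matches at the end of
  \<open>padovan_word\<close>, which is also the streak with which the cyclic scan has to start, and \<open>k\<close> is
  the number of blocks of at least \<open>p\<close> matches per period.
\<close>

definition scan_table :: "(nat \<times> nat \<times> nat) list" where
  "scan_table =
     [(1, 0, 14862), (2, 1, 12965), (3, 0, 11068), (5, 5, 4410), (6, 0, 1897), (8, 0, 3329),
     (11, 0, 1081), (13, 16, 1897), (19, 0, 816), (24, 3, 1081), (32, 0, 816), (37, 24, 616),
     (56, 3, 465), (69, 93, 351), (93, 24, 265), (125, 72, 200), (162, 24, 151), (218, 24, 114),
     (287, 311, 86), (380, 24, 65), (505, 72, 49), (667, 452, 37), (885, 24, 28),
     (1172, 1624, 21), (1552, 452, 16), (2057, 1196, 12), (2724, 452, 9), (3609, 452, 7),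
     (4781, 5233, 5), (6333, 452, 4), (8390, 7529, 3), (11114, 452, 2), (14723, 452, 2),
     (19504, 11566, 1), (25837, 452, 1), (34227, 33366, 1)]"

lemma padovan_word_append:
  "padovan_word @ zs =
     factor (Suc (Suc (Suc (Suc (Suc 0))))) C @ factor (Suc (Suc (Suc (Suc (Suc 0))))) A @
     factor (Suc (Suc (Suc (Suc (Suc 0))))) A @ zs"
  by (simp only: padovan_word_def numeral_nat append_assoc)

lemmas scan_rules = scan.simps(1) scan_skip scan_expand scan_match
  scan_mismatch[OF True_not_False] scan_mismatch[OF False_not_True]
  expand_0 expand_Suc factor_len_table even_zero even_Suc not_True_eq_False not_False_eq_True
  if_True if_False letter.distinct Suc_less_eq zero_less_Suc not_less0 add_num_simps le_num_simps less_num_simps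
  drop_to_factor drop_to_Cons drop_to_refl

text \<open>The block count starts at 1 so that it is always a \<open>numeral\<close>. Returning to
  \<open>c + 1\<close> confirms \<open>c\<close> as the cyclic streak.\<close>

lemma scan_table:
  assumes "(p, c, k) \<in> set scan_table"
  shows "scan p (c + 1) 1 padovan_word (drop p (padovan_word @ padovan_word)) = Some (c + 1, k + 1)"
proof -
  \<comment> \<open>The appended \<open>[]\<close> gives every factor a tail, as the rewrite rules
    require.\<close>
  have "\<forall>(p, c, k) \<in> set scan_table.
      scan p (c + 1) 1 (padovan_word @ []) (drop p (padovan_word @ padovan_word @ [])) =
        Some (c + 1, k + 1)"
    unfolding scan_table_def list.set ball_simps prod.case
    unfolding padovan_word_append drop_eq_drop_to numeral_One[symmetric]
      numeral_plus_numeral add_0_left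
    \<comment> \<open>With \<open>if_weak_cong\<close> only the condition is simplified, so
      discarded branches are never evaluated.\<close>
    by (intro conjI TrueI; simp only: scan_rules cong: if_weak_cong)
  with assms show ?thesis by auto
qed

lemma length_padovan_word: "length padovan_word = 60064"
proof -
  have "length (padovan_word @ []) = 60064"
    unfolding padovan_word_append length_append length_factor by simp
  then show ?thesis by simp
qed

section \<open>Runs of the periodic word and the limit\<close>

definition padovan_seq :: "nat \<Rightarrow> bool" where
  "padovan_seq i = padovan_word ! (i mod 60064)"

definition periods :: "nat set" where
  "periods = fst ` set scan_table"

definition lookup :: "nat \<Rightarrow> nat \<times> nat" where
  "lookup p = the (map_of scan_table p)"

lemma lookup_in_table:
  assumes "p \<in> periods"
  shows "(p, fst (lookup p), snd (lookup p)) \<in> set scan_table"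
proof -
  obtain y where "map_of scan_table p = Some y"
    using assms unfolding periods_def by (metis imageE map_of_eq_None_iff not_Some_eq rev_image_eqI)
  then show ?thesis
    by (auto simp: lookup_def dest: map_of_SomeD)
qed

lemma periods_facts:
  assumes "p \<in> periods"
  shows "1 \<le> p" "p < 60064" "snd (lookup p) > 0"
proof -
  have "\<forall>(p, c, k) \<in> set scan_table. 1 \<le> p \<and> p < 60064 \<and> k > 0"
    by (simp add: scan_table_def)
  with lookup_in_table[OF assms] show "1 \<le> p" "p < 60064" "snd (lookup p) > 0"
    by auto
qed

text \<open>The second alternative serves close pairs such as 5 and 6, whose difference 1 is again
  in \<open>periods\<close>.\<close>

lemma periods_gaps:
  assumes "p \<in> periods" "q \<in> periods" "p < q"
  shows "3 * p < 2 * q \<or> q - p \<in> periods \<and> 2 * (q - p) < q"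
proof -
  have "\<forall>p\<in>periods. \<forall>q\<in>periods. p < q \<longrightarrow>
      3 * p < 2 * q \<or> q - p \<in> periods \<and> 2 * (q - p) < q"
    unfolding periods_def scan_table_def list.set image_insert image_empty fst_conv ball_simps
    by (intro conjI TrueI; simp)
  with assms show ?thesis by blast
qed

lemma sum_lookup: "(\<Sum>p\<in>periods. snd (lookup p)) = 56733"
  by (simp add: periods_def lookup_def scan_table_def)

lemma streak_padovan_seq:
  fixes p
  defines "m \<equiv> \<lambda>z. padovan_seq z = padovan_seq (z + p)" and "c \<equiv> fst (lookup p)"
  assumes "p \<in> periods"
  shows "streak m c 60064 = c"
    and "card {z \<in> {0..<60064}. \<not> m z \<and> p \<le> streak m c z} = snd (lookup p)"
    and "\<forall>z<60064. \<not> m z \<longrightarrow> streak m c z \<le> 2 * p"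
proof -
  have scan: "scan p (streak m c 0 + 1) 1 padovan_word (drop p (padovan_word @ padovan_word)) =
      Some (c + 1, snd (lookup p) + 1)"
    using scan_table[OF lookup_in_table[OF assms(3)]] by (simp add: c_def)
  \<comment> \<open>Since \<open>p < 60064\<close>, two copies of the word contain every shifted
    position.\<close>
  have "m (0 + i) \<longleftrightarrow> padovan_word ! i = drop p (padovan_word @ padovan_word) ! i"
    if "i < length padovan_word" for i
    using that periods_facts(2)[OF assms(3)]
    by (auto simp: m_def padovan_seq_def length_padovan_word nth_append mod_if add.commute)
  from scan_sound[OF scan this, unfolded length_padovan_word]
  show "streak m c 60064 = c"
    and "card {z \<in> {0..<60064}. \<not> m z \<and> p \<le> streak m c z} = snd (lookup p)"
    and "\<forall>z<60064. \<not> m z \<longrightarrow> streak m c z \<le> 2 * p"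
    by simp_all
qed

lemma num_runs_padovan_seq: "(n div 60064 - 3) * 56733 \<le> num_runs (map padovan_seq [0..<n])"
proof -
  have periodic: "padovan_seq (z + 60064) = padovan_seq z" for z
    by (simp add: padovan_seq_def)
  have fin: "finite periods"
    by (simp add: periods_def)
  have "(n div 60064 - 3) * (\<Sum>p\<in>periods. card {z \<in> {0..<60064}.
      \<not> padovan_seq z = padovan_seq (z + p) \<and>
        p \<le> streak (\<lambda>z. padovan_seq z = padovan_seq (z + p)) (fst (lookup p)) z})
    \<le> num_runs (map padovan_seq [0..<n])"
  proof (rule num_runs_periodic_word[where c = "\<lambda>p. fst (lookup p)", OF _ fin])
    fix p assume p: "p \<in> periods"
    show "1 \<le> p \<and> p < 60064"
      using periods_facts[OF p] by simp
    show "streak (\<lambda>z. padovan_seq z = padovan_seq (z + p)) (fst (lookup p)) 60064 = fst (lookup p)"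
      by (rule streak_padovan_seq(1)[OF p])
    show "{z \<in> {0..<60064}. \<not> padovan_seq z = padovan_seq (z + p) \<and>
        p \<le> streak (\<lambda>z. padovan_seq z = padovan_seq (z + p)) (fst (lookup p)) z} \<noteq> {}"
      using streak_padovan_seq(2)[OF p] periods_facts(3)[OF p]
      by (metis card.empty less_numeral_extra(3))
    show "streak (\<lambda>z. padovan_seq z = padovan_seq (z + p)) (fst (lookup p)) z \<le> 2 * p"
      if "z < 60064" "\<not> padovan_seq z = padovan_seq (z + p)" for z
      using streak_padovan_seq(3)[OF p] that by blast
  qed (use periodic periods_gaps in auto)
  then show ?thesis
    by (simp only: streak_padovan_seq(2) sum_lookup cong: sum.cong)
qed

theorem theorem3:
  shows "\<forall>\<epsilon>::real. \<epsilon> > 0 \<longrightarrow>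
           (\<exists>N::nat. N > 0 \<and> (\<forall>n\<ge>N. real (rho n) > (56733 / 60064 - \<epsilon>) * real n))"
proof (intro allI impI)
  fix \<epsilon> :: real assume "\<epsilon> > 0"
  \<comment> \<open>At most four periods of 56733 counted runs are lost, one by rounding and three
    at the ends; from \<open>N\<close> on this loss is below
    \<open>\<epsilon> * real n\<close>.\<close>
  define N where "N = nat \<lceil>4 * 56733 / \<epsilon>\<rceil> + 1"
  have "real (rho n) > (56733 / 60064 - \<epsilon>) * real n" if "n \<ge> N" for n
  proof -
    have "4 * 56733 / \<epsilon> < real n"
      using that unfolding N_def by linarith
    then have "4 * 56733 < \<epsilon> * real n"
      using \<open>\<epsilon> > 0\<close> by (simp add: field_simps)
    moreover have "real n / 60064 - 4 \<le> real (n div 60064 - 3)"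
    proof -
      \<comment> \<open>If the subtraction is truncated, the claim reduces to
        \<open>n < 4 * 60064\<close>, which then holds.\<close>
      have "n < 60064 * (n div 60064 - 3) + 4 * 60064" by linarith
      then have "real n < real (60064 * (n div 60064 - 3) + 4 * 60064)"
        by (simp only: of_nat_less_iff)
      then show ?thesis by simp
    qed
    moreover have "real ((n div 60064 - 3) * 56733) \<le> real (rho n)"
      using num_runs_padovan_seq[of n] num_runs_le_rho[of "map padovan_seq [0..<n]"] by simp
    ultimately show ?thesis
      by (simp add: algebra_simps)
  qed
  then show "\<exists>N::nat. N > 0 \<and> (\<forall>n\<ge>N. real (rho n) > (56733 / 60064 - \<epsilon>) * real n)"
    by (intro exI[of _ N]) (simp add: N_def)
qed

end
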